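(* Let $\mathcal{C} \in \mathbb{R}_+^d$ denote target numerical conditions, let $\mathbf{x} \in \mathcal{X}$ be a parametric CAD token sequence, let $\boldsymbol{\theta}_{i-1}$ and $\boldsymbol{\theta}_i$ be the distribution parameters at steps $i-1$ and $i$, and let $\alpha$ be the accuracy parameter, all regarded as jointly distributed random variables. Suppose that $\mathcal{C}$ and $\mathbf{x}$ are conditionally independent given the current distribution parameters $\boldsymbol{\theta}_i$, in the sense that $$p(\boldsymbol{\theta}_{i-1},\mathbf{x},\alpha,\mathcal{C}\mid\boldsymbol{\theta}_{i}) = p(\boldsymbol{\theta}_{i-1},\mathbf{x},\alpha\mid\boldsymbol{\theta}_{i})\,p(\mathcal{C}\mid\boldsymbol{\theta}_{i}).$$ Then the conditional Bayesian update admits the decomposition $$p(\boldsymbol{\theta}_i\mid\boldsymbol{\theta}_{i-1},\mathbf{x},\alpha,\mathcal{C}) \propto p(\boldsymbol{\theta}_i\mid\boldsymbol{\theta}_{i-1},\mathbf{x},\alpha)\cdot p(\mathcal{C}\mid\boldsymbol{\theta}_i, \alpha),$$ where $\propto$ means equality as functions of $\boldsymbol{\theta}_i$ up to a factor that does not depend on $\boldsymbol{\theta}_i$ (it may depend on $\boldsymbol{\theta}_{i-1},\mathbf{x},\alpha,\mathcal{C}$).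
   Context: Token sequences: $\mathcal{X}=\{1,\dots,K\}^D$, where $K$ is the vocabulary size and $D$ the maximum sequence length. The distribution parameters $\boldsymbol{\theta}_i \in \mathbb{R}^{D\times K}$ form a matrix each of whose rows lies in the probability simplex $\Delta^{K-1}$ (row $d$ is a categorical distribution for the $d$-th token). $\alpha>0$ is an accuracy (precision) parameter. $\mathbb{R}_+^d$ is the set of vectors of $d$ positive real numbers (target numerical properties such as surface area and volume). The symbol $p(\cdot)$ denotes the joint probability density (or mass function), with respect to a fixed product reference measure, of the random variables $(\boldsymbol{\theta}_{i-1},\boldsymbol{\theta}_i,\mathbf{x},\alpha,\mathcal{C})$, and $p(\cdot\mid\cdot)$ denotes the corresponding marginal and conditional densities. The joint density is assumed to exist, and conditional densities are considered where the conditioning densities are positive. The factor $p(\boldsymbol{\theta}_i\mid\boldsymbol{\theta}_{i-1},\mathbf{x},\alpha)$ is called the standard Bayesian update and $p(\mathcal{C}\mid\boldsymbol{\theta}_i,\alpha)$ the conditional guidance. *)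

theory Defs
  imports "HOL-Probability.Probability"
begin

text \<open>The vocabulary is a finite type \<open>'k\<close> with \<open>K = CARD('k)\<close>, the sequence positions a finite type
  \<open>'n\<close> with \<open>D = CARD('n)\<close>. A token sequence is a vector of type \<open>'k ^ 'n\<close>; a matrix of distribution
  parameters has type \<open>real ^ 'k ^ 'n\<close>, and its rows \<open>\<theta> $ i\<close> are indexed by positions.\<close>

definition prob_simplex :: "(real ^ 'k) set" where
  "prob_simplex = {q. (\<forall>j. 0 \<le> q $ j) \<and> (\<Sum>j\<in>UNIV. q $ j) = 1}"

definition dist_params :: "(real ^ 'k ^ 'n) set" where
  "dist_params = {\<theta>. \<forall>i. \<theta> $ i \<in> prob_simplex}"

definition pos_vectors :: "(real ^ 'd) set" where
  "pos_vectors = {c. \<forall>j. 0 < c $ j}"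

text \<open>The density \<open>p(x)\<close> of the random variable \<open>X\<close> with respect to the reference measure \<open>S\<close>.
  Being a Radon-Nikodym derivative, it is determined only up to \<open>S\<close>-null sets, so equations between
  densities are to be read almost everywhere.\<close>

definition rv_density :: "'a measure \<Rightarrow> 'b measure \<Rightarrow> ('a \<Rightarrow> 'b) \<Rightarrow> 'b \<Rightarrow> ennreal" where
  "rv_density M S X = RN_deriv S (distr M S X)"

text \<open>The conditional density \<open>p(x | y) = p(x, y) / p(y)\<close> of \<open>X\<close> given \<open>Y\<close>, meaningful only where
  \<open>p(y) > 0\<close>.\<close>

definition cond_density ::
  "'a measure \<Rightarrow> 'b measure \<Rightarrow> 'c measure \<Rightarrow> ('a \<Rightarrow> 'b) \<Rightarrow> ('a \<Rightarrow> 'c) \<Rightarrow> 'b \<Rightarrow> 'c \<Rightarrow> ennreal" where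
  "cond_density M S T X Y x y =
     rv_density M (S \<Otimes>\<^sub>M T) (\<lambda>\<omega>. (X \<omega>, Y \<omega>)) (x, y) / rv_density M T Y y"

end

theory Submission
  imports Defs
begin

text \<open>Write \<open>t = \<theta>\<^sub>i\<close>, \<open>u = \<theta>\<^sub>i\<^sub>-\<^sub>1\<close>. Where \<open>p(t) > 0\<close>, conditional independence says
  \<open>p(t, u, x, a, c) = p(t, u, x, a) * p(c | t)\<close>. Integrating over \<open>(u, x)\<close> gives \<open>p(c, t, a) = p(t, a) * p(c | t)\<close>,
  so \<open>p(c | t, a) = p(c | t)\<close> wherever \<open>p(t, a) > 0\<close>, and the claim holds with factor
  \<open>r = p(u, x, a) / p(u, x, a, c)\<close>. The remaining work is to justify this for Radon-Nikodym
  derivatives, which are only defined almost everywhere and separately for each ordering of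
  the variables: null sets are pulled back along nonsingular maps, and densities are
  transported along measure-preserving reorderings.\<close>

text \<open>Absolute continuity of the image measure is what allows almost-everywhere statements on
  \<open>T\<close> to be pulled back along \<open>g\<close>. Preservation of measure would be too
  much to ask: a projection out of a product multiplies measures by the total mass of the discarded
  factor, which may be infinite.\<close>

definition nonsingular :: "'a measure \<Rightarrow> 'b measure \<Rightarrow> ('a \<Rightarrow> 'b) \<Rightarrow> bool" where
  "nonsingular S T g \<longleftrightarrow> g \<in> measurable S T \<and> absolutely_continuous T (distr S T g)"

text \<open>The measurable left inverse is what makes it possible to recover the law of
  \<open>X\<close> from the law of \<open>g\<close> applied to \<open>X\<close>.\<close>

definition measure_iso :: "'a measure \<Rightarrow> 'b measure \<Rightarrow> ('a \<Rightarrow> 'b) \<Rightarrow> bool" where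
  "measure_iso S T g \<longleftrightarrow> g \<in> measurable S T \<and> distr S T g = T \<and>
     (\<exists>h\<in>measurable T S. \<forall>x\<in>space S. h (g x) = x)"

text \<open>Since \<open>rv_density\<close> is a total function, it has to be stated separately that
  the Radon-Nikodym derivative really represents the law of \<open>X\<close>.\<close>

abbreviation has_density :: "'a measure \<Rightarrow> 'b measure \<Rightarrow> ('a \<Rightarrow> 'b) \<Rightarrow> bool" where
  "has_density M S X \<equiv> distributed M S X (rv_density M S X)"

section \<open>Nonsingular maps and the pullback of null sets\<close>

lemma nonsingularI:
  assumes "g \<in> measurable S T"
    and "\<And>N. N \<in> null_sets T \<Longrightarrow> AE x in S. g x \<notin> N"
  shows "nonsingular S T g"
  unfolding nonsingular_def absolutely_continuous_def
proof (intro conjI subsetI)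
  fix N assume N: "N \<in> null_sets T"
  then have "{x \<in> space S. \<not> g x \<notin> N} \<in> null_sets S"
    using assms by (intro AE_iff_null[THEN iffD1]) (auto intro: measurable_sets_Collect simp: null_sets_def)
  moreover have "{x \<in> space S. \<not> g x \<notin> N} = g -` N \<inter> space S" by auto
  ultimately show "N \<in> null_sets (distr S T g)"
    using assms(1) N by (simp add: null_sets_distr_iff null_setsD2)
qed fact

lemma nonsingular_measurable: "nonsingular S T g \<Longrightarrow> g \<in> measurable S T"
  by (simp add: nonsingular_def)

lemma nonsingular_AE:
  assumes "nonsingular S T g" "AE y in T. P y"
  shows "AE x in S. P (g x)"
proof -
  have "AE y in distr S T g. P y"
    using assms(1) by (intro absolutely_continuous_AE[OF _ _ assms(2)]) (auto simp: nonsingular_def)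
  with nonsingular_measurable[OF assms(1)] show ?thesis
    by (rule AE_distrD[of g S T P])
qed

lemma nonsingular_comp:
  assumes "nonsingular S T g" "nonsingular T U h"
  shows "nonsingular S U (\<lambda>x. h (g x))"
proof (rule nonsingularI)
  show "(\<lambda>x. h (g x)) \<in> measurable S U"
    by (rule measurable_compose[OF assms[THEN nonsingular_measurable]])
next
  fix N assume "N \<in> null_sets U"
  then show "AE x in S. h (g x) \<notin> N"
    using nonsingular_AE[OF assms(1), of "\<lambda>y. h y \<notin> N"] nonsingular_AE[OF assms(2), of "\<lambda>z. z \<notin> N"]
      AE_not_in[of N U] by simp
qed

lemma nonsingular_id: "nonsingular S S (\<lambda>x. x)"
  by (intro nonsingularI AE_not_in) auto

text \<open>The preimage of a null set is a rectangle with one null side. Its measure is 0 even when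
  the other side has infinite measure, because 0 times infinity is 0.\<close>

lemma nonsingular_fst:
  assumes "sigma_finite_measure T"
  shows "nonsingular (S \<Otimes>\<^sub>M T) S fst"
proof (rule nonsingularI)
  interpret T: sigma_finite_measure T by fact
  fix N assume N: "N \<in> null_sets S"
  then have "N \<times> space T \<in> null_sets (S \<Otimes>\<^sub>M T)"
    by (auto simp: null_sets_def T.emeasure_pair_measure_Times)
  then have "AE x in S \<Otimes>\<^sub>M T. x \<notin> N \<times> space T" by (rule AE_not_in)
  with AE_space show "AE x in S \<Otimes>\<^sub>M T. fst x \<notin> N"
    by eventually_elim (auto simp: space_pair_measure)
qed simp

lemma nonsingular_snd:
  assumes "sigma_finite_measure T"
  shows "nonsingular (S \<Otimes>\<^sub>M T) T snd"
proof (rule nonsingularI)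
  interpret T: sigma_finite_measure T by fact
  fix N assume N: "N \<in> null_sets T"
  then have "space S \<times> N \<in> null_sets (S \<Otimes>\<^sub>M T)"
    by (auto simp: null_sets_def T.emeasure_pair_measure_Times)
  then have "AE x in S \<Otimes>\<^sub>M T. x \<notin> space S \<times> N" by (rule AE_not_in)
  with AE_space show "AE x in S \<Otimes>\<^sub>M T. snd x \<notin> N"
    by eventually_elim (auto simp: space_pair_measure)
qed simp

text \<open>Almost every section of a null set in the product is null. The outer almost-everywhere
  quantifier is pulled back along \<open>g\<close>, then the inner one along \<open>h\<close>, and
  Tonelli reassembles the two.\<close>

lemma nonsingular_map_prod:
  assumes "sigma_finite_measure S" "sigma_finite_measure T"
    and "sigma_finite_measure S'" "sigma_finite_measure T'"
    and g: "nonsingular S S' g" and h: "nonsingular T T' h"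
  shows "nonsingular (S \<Otimes>\<^sub>M T) (S' \<Otimes>\<^sub>M T') (map_prod g h)"
proof (rule nonsingularI)
  interpret ST': pair_sigma_finite S' T' using assms by (intro pair_sigma_finite.intro)
  interpret ST: pair_sigma_finite S T using assms by (intro pair_sigma_finite.intro)
  have [measurable]: "g \<in> measurable S S'" "h \<in> measurable T T'"
    using g h by (auto simp: nonsingular_def)
  show meas [measurable]: "map_prod g h \<in> measurable (S \<Otimes>\<^sub>M T) (S' \<Otimes>\<^sub>M T')"
    by (simp add: map_prod_def)
  fix N assume N: "N \<in> null_sets (S' \<Otimes>\<^sub>M T')"
  then have [measurable]: "N \<in> sets (S' \<Otimes>\<^sub>M T')" by auto
  have "AE x in S'. AE y in T'. (x, y) \<notin> N"
    using N by (intro ST'.AE_pair AE_not_in)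
  then have "AE x in S. AE y in T'. (g x, y) \<notin> N"
    by (rule nonsingular_AE[OF g])
  then have "AE x in S. AE y in T. (g x, h y) \<notin> N"
    by eventually_elim (rule nonsingular_AE[OF h])
  then show "AE z in S \<Otimes>\<^sub>M T. map_prod g h z \<notin> N"
    by (intro ST.AE_pair_measure) simp_all
qed

section \<open>Measure-preserving reorderings of product spaces\<close>

lemma measure_isoE:
  assumes "measure_iso S T g"
  obtains h where "g \<in> measurable S T" "distr S T g = T" "h \<in> measurable T S"
    "\<forall>x\<in>space S. h (g x) = x"
  using assms unfolding measure_iso_def by blast

lemma measure_iso_imp_nonsingular: "measure_iso S T g \<Longrightarrow> nonsingular S T g"
  by (auto simp: measure_iso_def nonsingular_def absolutely_continuous_def)

lemma measure_iso_comp: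
  assumes "measure_iso S T g" "measure_iso T U h"
  shows "measure_iso S U (\<lambda>x. h (g x))"
proof -
  obtain g' where g: "g \<in> measurable S T" "distr S T g = T" "g' \<in> measurable T S"
    "\<forall>x\<in>space S. g' (g x) = x"
    using assms(1) by (rule measure_isoE)
  obtain h' where h: "h \<in> measurable T U" "distr T U h = U" "h' \<in> measurable U T"
    "\<forall>x\<in>space T. h' (h x) = x"
    using assms(2) by (rule measure_isoE)
  have "distr S U (h \<circ> g) = U"
    using distr_distr[OF h(1) g(1)] by (simp add: g(2) h(2))
  moreover have "g' (h' (h (g x))) = x" if "x \<in> space S" for x
    using that by (simp add: g(4) h(4) measurable_space[OF g(1)])
  ultimately show ?thesis
    unfolding measure_iso_def comp_def
    using measurable_compose[OF g(1) h(1)] measurable_compose[OF h(3) g(3)]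
    by (intro conjI bexI[of _ "\<lambda>x. g' (h' x)"] ballI)
qed

text \<open>Because \<open>T\<close> is the image of \<open>S\<close> under \<open>g\<close>, its
  image under \<open>h\<close> is the image of \<open>S\<close> under the identity.\<close>

lemma measure_iso_inverse:
  assumes "measure_iso S T g" and h: "h \<in> measurable T S"
    and inv: "\<And>x. x \<in> space S \<Longrightarrow> h (g x) = x" "\<And>y. y \<in> space T \<Longrightarrow> g (h y) = y"
  shows "measure_iso T S h"
proof -
  have g: "g \<in> measurable S T" and eq: "distr S T g = T"
    using assms(1) by (simp_all add: measure_iso_def)
  have "distr T S h = distr S S (h \<circ> g)"
    using distr_distr[OF h g] by (simp add: eq)
  also have "\<dots> = distr S S (\<lambda>x. x)" using inv(1) by (intro distr_cong) simp_all
  also have "\<dots> = S" by simp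
  finally show ?thesis unfolding measure_iso_def
    using g h inv(2) by (intro conjI bexI[of _ g] ballI)
qed

lemma measure_iso_swap:
  assumes "sigma_finite_measure S" "sigma_finite_measure T"
  shows "measure_iso (S \<Otimes>\<^sub>M T) (T \<Otimes>\<^sub>M S) (\<lambda>(x, y). (y, x))"
proof -
  interpret pair_sigma_finite T S using assms by (intro pair_sigma_finite.intro)
  show ?thesis unfolding measure_iso_def
    using distr_pair_swap by (auto intro!: bexI[of _ "\<lambda>(x, y). (y, x)"])
qed

lemma measure_iso_map_fst:
  assumes "sigma_finite_measure T" "measure_iso S S' g"
  shows "measure_iso (S \<Otimes>\<^sub>M T) (S' \<Otimes>\<^sub>M T) (\<lambda>(x, y). (g x, y))"
proof -
  obtain g' where [measurable]: "g \<in> measurable S S'" and eq: "distr S S' g = S'"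
    and [measurable]: "g' \<in> measurable S' S" and inv: "\<forall>x\<in>space S. g' (g x) = x"
    using assms(2) by (rule measure_isoE)
  have "distr S S' g \<Otimes>\<^sub>M distr T T (\<lambda>y. y) = distr (S \<Otimes>\<^sub>M T) (S' \<Otimes>\<^sub>M T) (\<lambda>(x, y). (g x, y))"
    using assms(1) by (intro pair_measure_distr) auto
  then have "distr (S \<Otimes>\<^sub>M T) (S' \<Otimes>\<^sub>M T) (\<lambda>(x, y). (g x, y)) = S' \<Otimes>\<^sub>M T"
    by (simp add: eq)
  then show ?thesis unfolding measure_iso_def
    using inv by (intro conjI bexI[of _ "\<lambda>(x, y). (g' x, y)"]) (auto simp: space_pair_measure)
qed

text \<open>By Tonelli, both bracketings give a measurable set the same value, the threefold
  iterated integral of its indicator.\<close>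

lemma measure_iso_assoc_right:
  assumes "sigma_finite_measure S" "sigma_finite_measure T" "sigma_finite_measure U"
  shows "measure_iso ((S \<Otimes>\<^sub>M T) \<Otimes>\<^sub>M U) (S \<Otimes>\<^sub>M (T \<Otimes>\<^sub>M U)) (\<lambda>((x, y), z). (x, y, z))"
proof -
  interpret T: sigma_finite_measure T by fact
  interpret U: sigma_finite_measure U by fact
  interpret TU: sigma_finite_measure "T \<Otimes>\<^sub>M U" using assms by (intro sigma_finite_pair_measure)
  let ?g = "\<lambda>((x, y), z). (x, y, z)"
  have [measurable]: "?g \<in> measurable ((S \<Otimes>\<^sub>M T) \<Otimes>\<^sub>M U) (S \<Otimes>\<^sub>M (T \<Otimes>\<^sub>M U))"
    by (simp add: split_beta')
  have "distr ((S \<Otimes>\<^sub>M T) \<Otimes>\<^sub>M U) (S \<Otimes>\<^sub>M (T \<Otimes>\<^sub>M U)) ?g = S \<Otimes>\<^sub>M (T \<Otimes>\<^sub>M U)"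
  proof (rule measure_eqI)
    fix A assume "A \<in> sets (distr ((S \<Otimes>\<^sub>M T) \<Otimes>\<^sub>M U) (S \<Otimes>\<^sub>M (T \<Otimes>\<^sub>M U)) ?g)"
    then have A [measurable]: "A \<in> sets (S \<Otimes>\<^sub>M (T \<Otimes>\<^sub>M U))" by simp
    have "emeasure (distr ((S \<Otimes>\<^sub>M T) \<Otimes>\<^sub>M U) (S \<Otimes>\<^sub>M (T \<Otimes>\<^sub>M U)) ?g) A =
        (\<integral>\<^sup>+w. indicator A (?g w) \<partial>((S \<Otimes>\<^sub>M T) \<Otimes>\<^sub>M U))"
      by (subst nn_integral_indicator[symmetric], simp, subst nn_integral_distr) auto
    also have "\<dots> = (\<integral>\<^sup>+x. \<integral>\<^sup>+y. \<integral>\<^sup>+z. indicator A (x, y, z) \<partial>U \<partial>T \<partial>S)"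
      by (subst U.nn_integral_fst[symmetric], measurable, subst T.nn_integral_fst[symmetric], auto)
    also have "\<dots> = (\<integral>\<^sup>+w. indicator A w \<partial>(S \<Otimes>\<^sub>M (T \<Otimes>\<^sub>M U)))"
      by (subst TU.nn_integral_fst[symmetric], measurable,
          intro nn_integral_cong, subst U.nn_integral_fst[symmetric]) auto
    finally show "emeasure (distr ((S \<Otimes>\<^sub>M T) \<Otimes>\<^sub>M U) (S \<Otimes>\<^sub>M (T \<Otimes>\<^sub>M U)) ?g) A = emeasure (S \<Otimes>\<^sub>M (T \<Otimes>\<^sub>M U)) A"
      by simp
  qed simp
  moreover have "(\<lambda>(x, y, z). ((x, y), z)) \<in> measurable (S \<Otimes>\<^sub>M (T \<Otimes>\<^sub>M U)) ((S \<Otimes>\<^sub>M T) \<Otimes>\<^sub>M U)"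
    by (simp add: split_beta')
  ultimately show ?thesis unfolding measure_iso_def
    by (intro conjI bexI[of _ "\<lambda>(x, y, z). ((x, y), z)"]) auto
qed

lemma measure_iso_assoc_left:
  assumes "sigma_finite_measure S" "sigma_finite_measure T" "sigma_finite_measure U"
  shows "measure_iso (S \<Otimes>\<^sub>M (T \<Otimes>\<^sub>M U)) ((S \<Otimes>\<^sub>M T) \<Otimes>\<^sub>M U) (\<lambda>(x, y, z). ((x, y), z))"
  by (rule measure_iso_inverse[OF measure_iso_assoc_right[OF assms]]) (auto simp: split_beta')

section \<open>Densities of random variables and of their images\<close>

lemma distributed_absolutely_continuous:
  assumes "distributed M S X p"
  shows "absolutely_continuous S (distr M S X)"
  unfolding distributed_distr_eq_density[OF assms]
  by (rule absolutely_continuousI_density) (rule distributed_borel_measurable[OF assms])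

lemma has_densityI:
  assumes "sigma_finite_measure S" "X \<in> measurable M S" "absolutely_continuous S (distr M S X)"
  shows "has_density M S X"
  using assms(2) sigma_finite_measure.density_RN_deriv[OF assms(1,3)]
  by (simp add: distributed_def rv_density_def)

text \<open>Any density at all forces absolute continuity of the law, and then Radon-Nikodym shows
  that the canonical version is a density too.\<close>

lemma distributed_imp_has_density:
  assumes "sigma_finite_measure S" "distributed M S X p"
  shows "has_density M S X"
  by (intro has_densityI assms distributed_measurable[OF assms(2)]
      distributed_absolutely_continuous[OF assms(2)])

lemma has_density_nonsingular: "has_density M S X \<Longrightarrow> nonsingular M S X"
  unfolding nonsingular_def by (intro conjI distributed_measurable distributed_absolutely_continuous)

lemma has_density_image:
  assumes "sigma_finite_measure T" "has_density M S X" "nonsingular S T g"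
    and Y: "Y = (\<lambda>\<omega>. g (X \<omega>))"
  shows "has_density M T Y"
  using assms(1) nonsingular_comp[OF has_density_nonsingular[OF assms(2)] assms(3)]
  by (intro has_densityI) (simp_all add: nonsingular_def Y)

text \<open>Pushing the law of \<open>Y\<close> back along the left inverse shows that the density
  of \<open>Y\<close> composed with \<open>g\<close> is a density of the law of \<open>X\<close>.
  Uniqueness of Radon-Nikodym derivatives identifies it with the canonical one, almost
  everywhere.\<close>

lemma rv_density_measure_iso:
  assumes "sigma_finite_measure S" "sigma_finite_measure T" "has_density M S X" "measure_iso S T g"
    and Y: "Y = (\<lambda>\<omega>. g (X \<omega>))"
  shows "AE z in S. rv_density M T Y (g z) = rv_density M S X z"
proof -
  obtain g' where g: "g \<in> measurable S T" and eq: "distr S T g = T"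
    and g': "g' \<in> measurable T S" and inv: "\<forall>x\<in>space S. g' (g x) = x"
    using assms(4) by (rule measure_isoE)
  have X: "X \<in> measurable M S"
    by (rule distributed_measurable[OF assms(3)])
  have dY: "has_density M T Y"
    by (rule has_density_image[OF assms(2,3) measure_iso_imp_nonsingular[OF assms(4)] Y])
  have f: "rv_density M T Y \<in> borel_measurable T"
    by (rule distributed_borel_measurable[OF dY])
  have "density S (rv_density M T Y \<circ> g) = distr (density (distr S T g) (rv_density M T Y)) S g'"
    by (rule distr_density_distr[OF g g' inv f, symmetric])
  also have "\<dots> = distr (distr M T Y) S g'"
    by (simp only: eq distributed_distr_eq_density[OF dY])
  also have "\<dots> = distr M S (g' \<circ> Y)"
    by (rule distr_distr[OF g' distributed_measurable[OF dY]])
  also have "\<dots> = distr M S X"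
    using inv measurable_space[OF X] by (intro distr_cong) (simp_all add: Y)
  finally have "AE z in S. (rv_density M T Y \<circ> g) z = RN_deriv S (distr M S X) z"
    by (rule sigma_finite_measure.RN_deriv_unique[OF assms(1) measurable_comp[OF g f]])
  then show ?thesis
    by (simp add: rv_density_def)
qed

text \<open>The law of \<open>X\<close> is a probability measure, hence sigma-finite, and the
  derivative of a sigma-finite measure is finite almost everywhere. This supplies finite
  denominators for the conditional densities.\<close>

lemma rv_density_finite:
  assumes "prob_space M" "sigma_finite_measure S" "has_density M S X"
  shows "AE x in S. rv_density M S X x < \<infinity>"
proof -
  have [measurable]: "X \<in> measurable M S" and ac: "absolutely_continuous S (distr M S X)"
    using distributed_measurable[OF assms(3)] distributed_absolutely_continuous[OF assms(3)] .
  have "prob_space (distr M S X)"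
    using assms(1) by (rule prob_space.prob_space_distr) simp
  then have "sigma_finite_measure (distr M S X)"
    by (rule prob_space_imp_sigma_finite)
  then have "AE x in S. RN_deriv S (distr M S X) x \<noteq> \<infinity>"
    using sigma_finite_measure.RN_deriv_finite[OF assms(2) _ ac] by simp
  then show ?thesis by (simp add: rv_density_def less_top)
qed

section \<open>Ratios of extended nonnegative reals\<close>

text \<open>Cancellation rests on \<open>p / p = 1\<close>; for \<open>p = 0\<close> and for
  \<open>p = top\<close> that quotient is 0 instead.\<close>

lemma ennreal_divide_cancel_times:
  fixes f p q K :: ennreal
  assumes "0 < p" "p < \<infinity>" "f / p = q / p * K"
  shows "f = q * K"
proof -
  have p: "p \<noteq> 0" "p \<noteq> top" using assms by auto
  have pp: "p / p = 1" using p by (simp add: less_top)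
  have "f = f / p * p" by (simp add: pp ennreal_divide_times)
  also have "\<dots> = (q / p * p) * K" by (simp add: assms(3) mult_ac)
  also have "\<dots> = q * K" by (simp add: pp ennreal_divide_times)
  finally show ?thesis .
qed

text \<open>The final computation in abstract form: \<open>u\<close> and \<open>v\<close> are the
  densities of the conditioning variables with and without the condition, \<open>b * K / b\<close>
  is the guidance term. The values \<open>q\<close> and \<open>K\<close> may be infinite. The detour
  through \<open>enn2real\<close> is harmless because \<open>v / u\<close> is finite, and it makes
  the factor a real number.\<close>

lemma ennreal_ratio_decomposition:
  fixes q K u v b :: ennreal
  assumes "0 < u" "u < \<infinity>" "0 < v" "v < \<infinity>" "0 < b" "b < \<infinity>"
  shows "q * K / u = ennreal (enn2real (v / u)) * (q / v * (b * K / b))"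
proof -
  have nz: "u \<noteq> 0" "u \<noteq> top" "v \<noteq> 0" "v \<noteq> top" "b \<noteq> 0" "b \<noteq> top"
    using assms by auto
  have "v / u < top"
    using nz by (simp add: less_top[symmetric] ennreal_divide_eq_top_iff)
  then have r: "ennreal (enn2real (v / u)) = v / u" by simp
  have "b * K / b = K"
    using nz by (simp add: mult.commute[of b] mult_divide_eq_ennreal)
  then have "v / u * (q / v * (b * K / b)) = (v / v) * (q * K / u)"
    by (simp add: divide_ennreal_def mult_ac)
  also have "\<dots> = q * K / u" using nz by (simp add: less_top)
  finally show ?thesis by (simp add: r)
qed

lemma enn2real_divide_pos:
  fixes u v :: ennreal
  assumes "0 < u" "u < \<infinity>" "0 < v" "v < \<infinity>"
  shows "0 < enn2real (v / u)"
proof -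
  have "v / u < top"
    using assms by (auto simp: less_top[symmetric] ennreal_divide_eq_top_iff)
  moreover have "0 < v / u"
    using assms by (simp add: ennreal_zero_less_divide)
  ultimately show ?thesis by (simp add: enn2real_positive_iff)
qed

theorem theorem4p1:
  fixes M :: "'a measure"
    and \<Theta>0 \<Theta>1 :: "'a \<Rightarrow> real ^ 'k ^ 'n"
    and X :: "'a \<Rightarrow> 'k ^ 'n"
    and A :: "'a \<Rightarrow> real"
    and C :: "'a \<Rightarrow> real ^ 'd"
    and N0 N1 :: "(real ^ 'k ^ 'n) measure"
    and Nx :: "('k ^ 'n) measure"
    and Na :: "real measure"
    and Nc :: "(real ^ 'd) measure"
  assumes "prob_space M"
    and "sigma_finite_measure N0" and "sets N0 = sets (restrict_space borel dist_params)"
    and "sigma_finite_measure N1" and "sets N1 = sets (restrict_space borel dist_params)"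
    and "sigma_finite_measure Nx" and "sets Nx = sets (count_space UNIV)"
    and "sigma_finite_measure Na" and "sets Na = sets (restrict_space borel {0<..})"
    and "sigma_finite_measure Nc" and "sets Nc = sets (restrict_space borel pos_vectors)"
    and joint_density:
      "\<exists>p. distributed M (N0 \<Otimes>\<^sub>M N1 \<Otimes>\<^sub>M Nx \<Otimes>\<^sub>M Na \<Otimes>\<^sub>M Nc)
             (\<lambda>\<omega>. (\<Theta>0 \<omega>, \<Theta>1 \<omega>, X \<omega>, A \<omega>, C \<omega>)) p"
    and cond_indep:
      "AE (\<theta>1, \<theta>0, x, a, c) in N1 \<Otimes>\<^sub>M N0 \<Otimes>\<^sub>M Nx \<Otimes>\<^sub>M Na \<Otimes>\<^sub>M Nc.
         rv_density M N1 \<Theta>1 \<theta>1 > 0 \<longrightarrow>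
         cond_density M (N0 \<Otimes>\<^sub>M Nx \<Otimes>\<^sub>M Na \<Otimes>\<^sub>M Nc) N1
             (\<lambda>\<omega>. (\<Theta>0 \<omega>, X \<omega>, A \<omega>, C \<omega>)) \<Theta>1 (\<theta>0, x, a, c) \<theta>1 =
         cond_density M (N0 \<Otimes>\<^sub>M Nx \<Otimes>\<^sub>M Na) N1
             (\<lambda>\<omega>. (\<Theta>0 \<omega>, X \<omega>, A \<omega>)) \<Theta>1 (\<theta>0, x, a) \<theta>1 *
         cond_density M Nc N1 C \<Theta>1 c \<theta>1"
  shows
    "AE (\<theta>0, x, a, c) in N0 \<Otimes>\<^sub>M Nx \<Otimes>\<^sub>M Na \<Otimes>\<^sub>M Nc.
       rv_density M (N0 \<Otimes>\<^sub>M Nx \<Otimes>\<^sub>M Na \<Otimes>\<^sub>M Nc) (\<lambda>\<omega>. (\<Theta>0 \<omega>, X \<omega>, A \<omega>, C \<omega>)) (\<theta>0, x, a, c) > 0 \<and>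
       rv_density M (N0 \<Otimes>\<^sub>M Nx \<Otimes>\<^sub>M Na) (\<lambda>\<omega>. (\<Theta>0 \<omega>, X \<omega>, A \<omega>)) (\<theta>0, x, a) > 0 \<longrightarrow>
       (\<exists>r::real. r > 0 \<and>
          (AE \<theta>1 in N1.
             rv_density M (N1 \<Otimes>\<^sub>M Na) (\<lambda>\<omega>. (\<Theta>1 \<omega>, A \<omega>)) (\<theta>1, a) > 0 \<longrightarrow>
             cond_density M N1 (N0 \<Otimes>\<^sub>M Nx \<Otimes>\<^sub>M Na \<Otimes>\<^sub>M Nc)
                 \<Theta>1 (\<lambda>\<omega>. (\<Theta>0 \<omega>, X \<omega>, A \<omega>, C \<omega>)) \<theta>1 (\<theta>0, x, a, c) =
             ennreal r *
             (cond_density M N1 (N0 \<Otimes>\<^sub>M Nx \<Otimes>\<^sub>M Na)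
                  \<Theta>1 (\<lambda>\<omega>. (\<Theta>0 \<omega>, X \<omega>, A \<omega>)) \<theta>1 (\<theta>0, x, a) *
              cond_density M Nc (N1 \<Otimes>\<^sub>M Na)
                  C (\<lambda>\<omega>. (\<Theta>1 \<omega>, A \<omega>)) c (\<theta>1, a))))"
proof -
  note M = assms(1)
  note N0 = assms(2) and N1 = assms(4) and Nx = assms(6) and Na = assms(8) and Nc = assms(10)
  note sf = N0 N1 Nx Na Nc sigma_finite_pair_measure

  let ?W3 = "N0 \<Otimes>\<^sub>M Nx \<Otimes>\<^sub>M Na"
  let ?W4 = "N0 \<Otimes>\<^sub>M Nx \<Otimes>\<^sub>M Na \<Otimes>\<^sub>M Nc"
  let ?U = "N0 \<Otimes>\<^sub>M Nx"
  \<comment> \<open>Primed versions are the same joint density with the variables in another order: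
    \<open>f\<close> of all variables, \<open>q\<close> of all but the condition \<open>C\<close>.\<close>
  define f where "f = rv_density M (?W4 \<Otimes>\<^sub>M N1) (\<lambda>\<omega>. ((\<Theta>0 \<omega>, X \<omega>, A \<omega>, C \<omega>), \<Theta>1 \<omega>))"
  define f' where "f' = rv_density M (N1 \<Otimes>\<^sub>M ?W4) (\<lambda>\<omega>. (\<Theta>1 \<omega>, \<Theta>0 \<omega>, X \<omega>, A \<omega>, C \<omega>))"
  define f'' where "f'' = rv_density M ((Nc \<Otimes>\<^sub>M N1 \<Otimes>\<^sub>M Na) \<Otimes>\<^sub>M ?U) (\<lambda>\<omega>. ((C \<omega>, \<Theta>1 \<omega>, A \<omega>), \<Theta>0 \<omega>, X \<omega>))"
  define q where "q = rv_density M (?W3 \<Otimes>\<^sub>M N1) (\<lambda>\<omega>. ((\<Theta>0 \<omega>, X \<omega>, A \<omega>), \<Theta>1 \<omega>))"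
  define q' where "q' = rv_density M (N1 \<Otimes>\<^sub>M ?W3) (\<lambda>\<omega>. (\<Theta>1 \<omega>, \<Theta>0 \<omega>, X \<omega>, A \<omega>))"
  define q'' where "q'' = rv_density M ((N1 \<Otimes>\<^sub>M Na) \<Otimes>\<^sub>M ?U) (\<lambda>\<omega>. ((\<Theta>1 \<omega>, A \<omega>), \<Theta>0 \<omega>, X \<omega>))"
  define p where "p = rv_density M N1 \<Theta>1"
  define b where "b = rv_density M (N1 \<Otimes>\<^sub>M Na) (\<lambda>\<omega>. (\<Theta>1 \<omega>, A \<omega>))"
  define e where "e = rv_density M (Nc \<Otimes>\<^sub>M N1 \<Otimes>\<^sub>M Na) (\<lambda>\<omega>. (C \<omega>, \<Theta>1 \<omega>, A \<omega>))"
  define u where "u = rv_density M ?W4 (\<lambda>\<omega>. (\<Theta>0 \<omega>, X \<omega>, A \<omega>, C \<omega>))"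
  define v where "v = rv_density M ?W3 (\<lambda>\<omega>. (\<Theta>0 \<omega>, X \<omega>, A \<omega>))"
  define K where "K c t = cond_density M Nc N1 C \<Theta>1 c t" for c t

  \<comment> \<open>Projections and reorderings of the five variables\<close>
  have drop_c: "nonsingular ?W4 ?W3 (map_prod (\<lambda>x. x) (map_prod (\<lambda>x. x) fst))"
    by (intro nonsingular_map_prod nonsingular_id nonsingular_fst sf)
  have to_W4: "nonsingular (?W4 \<Otimes>\<^sub>M N1) ?W4 fst" and to_N1: "nonsingular (?W4 \<Otimes>\<^sub>M N1) N1 snd"
    by (intro nonsingular_fst nonsingular_snd sf)+
  have to_W3: "nonsingular (?W4 \<Otimes>\<^sub>M N1) (?W3 \<Otimes>\<^sub>M N1)
      (map_prod (map_prod (\<lambda>x. x) (map_prod (\<lambda>x. x) fst)) (\<lambda>x. x))"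
    by (intro nonsingular_map_prod nonsingular_id drop_c sf)

  \<comment> \<open>The target order collects \<open>(\<theta>0, x)\<close>, the variables to be
    integrated out, in one last factor. Steps 1 to 3 split this pair off and move it to the right;
    steps 4 to 6 turn the remaining \<open>((a, c), t)\<close> into
    \<open>(c, t, a)\<close>.\<close>
  have iso_W4: "measure_iso (?W4 \<Otimes>\<^sub>M N1) ((Nc \<Otimes>\<^sub>M N1 \<Otimes>\<^sub>M Na) \<Otimes>\<^sub>M ?U)
      (\<lambda>((\<theta>0, x, a, c), t). ((c, t, a), \<theta>0, x))"
  proof -
    have 1: "measure_iso (?W4 \<Otimes>\<^sub>M N1) ((?U \<Otimes>\<^sub>M (Na \<Otimes>\<^sub>M Nc)) \<Otimes>\<^sub>M N1) (\<lambda>(w, t). ((\<lambda>(x, y, z). ((x, y), z)) w, t))"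
      by (intro measure_iso_map_fst measure_iso_assoc_left sf)
    have 2: "measure_iso ((?U \<Otimes>\<^sub>M (Na \<Otimes>\<^sub>M Nc)) \<Otimes>\<^sub>M N1) (?U \<Otimes>\<^sub>M ((Na \<Otimes>\<^sub>M Nc) \<Otimes>\<^sub>M N1)) (\<lambda>((x, y), z). (x, y, z))"
      by (intro measure_iso_assoc_right sf)
    have 3: "measure_iso (?U \<Otimes>\<^sub>M ((Na \<Otimes>\<^sub>M Nc) \<Otimes>\<^sub>M N1)) (((Na \<Otimes>\<^sub>M Nc) \<Otimes>\<^sub>M N1) \<Otimes>\<^sub>M ?U) (\<lambda>(x, y). (y, x))"
      by (intro measure_iso_swap sf)
    have 4: "measure_iso ((Na \<Otimes>\<^sub>M Nc) \<Otimes>\<^sub>M N1) (N1 \<Otimes>\<^sub>M (Na \<Otimes>\<^sub>M Nc)) (\<lambda>(x, y). (y, x))"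
      by (intro measure_iso_swap sf)
    have 5: "measure_iso (N1 \<Otimes>\<^sub>M (Na \<Otimes>\<^sub>M Nc)) ((N1 \<Otimes>\<^sub>M Na) \<Otimes>\<^sub>M Nc) (\<lambda>(x, y, z). ((x, y), z))"
      by (intro measure_iso_assoc_left sf)
    have 6: "measure_iso ((N1 \<Otimes>\<^sub>M Na) \<Otimes>\<^sub>M Nc) (Nc \<Otimes>\<^sub>M N1 \<Otimes>\<^sub>M Na) (\<lambda>(x, y). (y, x))"
      by (intro measure_iso_swap sf)
    have 7: "sigma_finite_measure ?U" by (intro sf)
    show ?thesis
      using measure_iso_comp[OF 1 measure_iso_comp[OF 2 measure_iso_comp[OF 3
            measure_iso_map_fst[OF 7 measure_iso_comp[OF 4 measure_iso_comp[OF 5 6]]]]]]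
      by (simp add: split_beta')
  qed
  \<comment> \<open>The forward map transports the existence of densities; this inverse pulls
    almost-everywhere identities back to the order adapted to integration.\<close>
  have iso_W4': "measure_iso ((Nc \<Otimes>\<^sub>M N1 \<Otimes>\<^sub>M Na) \<Otimes>\<^sub>M ?U) (?W4 \<Otimes>\<^sub>M N1)
      (\<lambda>((c, t, a), \<theta>0, x). ((\<theta>0, x, a, c), t))"
    by (rule measure_iso_inverse[OF iso_W4]) (auto simp: split_beta')
  have iso_W3: "measure_iso (?W3 \<Otimes>\<^sub>M N1) ((N1 \<Otimes>\<^sub>M Na) \<Otimes>\<^sub>M ?U)
      (\<lambda>((\<theta>0, x, a), t). ((t, a), \<theta>0, x))"
  proof -
    have 1: "measure_iso (?W3 \<Otimes>\<^sub>M N1) ((?U \<Otimes>\<^sub>M Na) \<Otimes>\<^sub>M N1) (\<lambda>(w, t). ((\<lambda>(x, y, z). ((x, y), z)) w, t))"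
      by (intro measure_iso_map_fst measure_iso_assoc_left sf)
    have 2: "measure_iso ((?U \<Otimes>\<^sub>M Na) \<Otimes>\<^sub>M N1) (?U \<Otimes>\<^sub>M (Na \<Otimes>\<^sub>M N1)) (\<lambda>((x, y), z). (x, y, z))"
      by (intro measure_iso_assoc_right sf)
    have 3: "measure_iso (?U \<Otimes>\<^sub>M (Na \<Otimes>\<^sub>M N1)) ((Na \<Otimes>\<^sub>M N1) \<Otimes>\<^sub>M ?U) (\<lambda>(x, y). (y, x))"
      by (intro measure_iso_swap sf)
    have 4: "measure_iso (Na \<Otimes>\<^sub>M N1) (N1 \<Otimes>\<^sub>M Na) (\<lambda>(x, y). (y, x))"
      by (intro measure_iso_swap sf)
    have 5: "sigma_finite_measure ?U" by (intro sf)
    show ?thesis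
      using measure_iso_comp[OF 1 measure_iso_comp[OF 2 measure_iso_comp[OF 3
            measure_iso_map_fst[OF 5 4]]]]
      by (simp add: split_beta')
  qed
  have iso_W3': "measure_iso ((N1 \<Otimes>\<^sub>M Na) \<Otimes>\<^sub>M ?U) (?W3 \<Otimes>\<^sub>M N1)
      (\<lambda>((t, a), \<theta>0, x). ((\<theta>0, x, a), t))"
    by (rule measure_iso_inverse[OF iso_W3]) (auto simp: split_beta')
  have iso_joint: "measure_iso (N0 \<Otimes>\<^sub>M N1 \<Otimes>\<^sub>M Nx \<Otimes>\<^sub>M Na \<Otimes>\<^sub>M Nc) (?W4 \<Otimes>\<^sub>M N1)
      (\<lambda>(\<theta>0, t, w). ((\<theta>0, w), t))"
  proof -
    let ?R = "Nx \<Otimes>\<^sub>M Na \<Otimes>\<^sub>M Nc"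
    have 1: "measure_iso (N0 \<Otimes>\<^sub>M N1 \<Otimes>\<^sub>M ?R) ((N1 \<Otimes>\<^sub>M ?R) \<Otimes>\<^sub>M N0) (\<lambda>(x, y). (y, x))"
      by (intro measure_iso_swap sf)
    have 2: "measure_iso ((N1 \<Otimes>\<^sub>M ?R) \<Otimes>\<^sub>M N0) (N1 \<Otimes>\<^sub>M (?R \<Otimes>\<^sub>M N0)) (\<lambda>((x, y), z). (x, y, z))"
      by (intro measure_iso_assoc_right sf)
    have 3: "measure_iso (N1 \<Otimes>\<^sub>M (?R \<Otimes>\<^sub>M N0)) ((?R \<Otimes>\<^sub>M N0) \<Otimes>\<^sub>M N1) (\<lambda>(x, y). (y, x))"
      by (intro measure_iso_swap sf)
    have 4: "measure_iso (?R \<Otimes>\<^sub>M N0) (N0 \<Otimes>\<^sub>M ?R) (\<lambda>(x, y). (y, x))"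
      by (intro measure_iso_swap sf)
    show ?thesis
      using measure_iso_comp[OF 1 measure_iso_comp[OF 2 measure_iso_comp[OF 3
            measure_iso_map_fst[OF N1 4]]]]
      by (simp add: split_beta')
  qed
  have swap_W4: "measure_iso (?W4 \<Otimes>\<^sub>M N1) (N1 \<Otimes>\<^sub>M ?W4) (\<lambda>(x, y). (y, x))"
    and swap_W3: "measure_iso (?W3 \<Otimes>\<^sub>M N1) (N1 \<Otimes>\<^sub>M ?W3) (\<lambda>(x, y). (y, x))"
    by (intro measure_iso_swap sf)+
  have to_e: "nonsingular (?W4 \<Otimes>\<^sub>M N1) (Nc \<Otimes>\<^sub>M N1 \<Otimes>\<^sub>M Na) (\<lambda>((\<theta>0, x, a, c), t). (c, t, a))"
    using nonsingular_comp[OF measure_iso_imp_nonsingular[OF iso_W4]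
        nonsingular_fst[OF sigma_finite_pair_measure[OF N0 Nx]]]
    by (simp add: split_beta')
  have to_b: "nonsingular (?W4 \<Otimes>\<^sub>M N1) (N1 \<Otimes>\<^sub>M Na) (\<lambda>((\<theta>0, x, a, c), t). (t, a))"
    using nonsingular_comp[OF to_e nonsingular_snd[OF sigma_finite_pair_measure[OF N1 Na]]]
    by (simp add: split_beta')

  \<comment> \<open>Existence, finiteness and agreement of the marginal and reordered
    densities\<close>
  have df: "has_density M (?W4 \<Otimes>\<^sub>M N1) (\<lambda>\<omega>. ((\<Theta>0 \<omega>, X \<omega>, A \<omega>, C \<omega>), \<Theta>1 \<omega>))"
  proof -
    have "has_density M (N0 \<Otimes>\<^sub>M N1 \<Otimes>\<^sub>M Nx \<Otimes>\<^sub>M Na \<Otimes>\<^sub>M Nc) (\<lambda>\<omega>. (\<Theta>0 \<omega>, \<Theta>1 \<omega>, X \<omega>, A \<omega>, C \<omega>))"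
      using joint_density by (auto intro!: distributed_imp_has_density sf)
    then show ?thesis
      by (rule has_density_image[OF _ _ measure_iso_imp_nonsingular[OF iso_joint], rotated])
        (auto intro!: sf)
  qed
  have dq: "has_density M (?W3 \<Otimes>\<^sub>M N1) (\<lambda>\<omega>. ((\<Theta>0 \<omega>, X \<omega>, A \<omega>), \<Theta>1 \<omega>))"
    by (rule has_density_image[OF _ df to_W3]) (auto intro!: sf)
  have df'': "has_density M ((Nc \<Otimes>\<^sub>M N1 \<Otimes>\<^sub>M Na) \<Otimes>\<^sub>M ?U) (\<lambda>\<omega>. ((C \<omega>, \<Theta>1 \<omega>, A \<omega>), \<Theta>0 \<omega>, X \<omega>))"
    by (rule has_density_image[OF _ df measure_iso_imp_nonsingular[OF iso_W4]]) (auto intro!: sf)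
  have dq'': "has_density M ((N1 \<Otimes>\<^sub>M Na) \<Otimes>\<^sub>M ?U) (\<lambda>\<omega>. ((\<Theta>1 \<omega>, A \<omega>), \<Theta>0 \<omega>, X \<omega>))"
    by (rule has_density_image[OF _ dq measure_iso_imp_nonsingular[OF iso_W3]]) (auto intro!: sf)
  have dp: "has_density M N1 \<Theta>1"
    by (rule has_density_image[OF _ df to_N1]) (auto intro!: sf)
  have du: "has_density M ?W4 (\<lambda>\<omega>. (\<Theta>0 \<omega>, X \<omega>, A \<omega>, C \<omega>))"
    by (rule has_density_image[OF _ df to_W4]) (auto intro!: sf)
  have dv: "has_density M ?W3 (\<lambda>\<omega>. (\<Theta>0 \<omega>, X \<omega>, A \<omega>))"
    by (rule has_density_image[OF _ du drop_c]) (auto intro!: sf)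
  have de: "has_density M (Nc \<Otimes>\<^sub>M N1 \<Otimes>\<^sub>M Na) (\<lambda>\<omega>. (C \<omega>, \<Theta>1 \<omega>, A \<omega>))"
    by (rule has_density_image[OF _ df to_e]) (auto intro!: sf)
  have db: "has_density M (N1 \<Otimes>\<^sub>M Na) (\<lambda>\<omega>. (\<Theta>1 \<omega>, A \<omega>))"
    by (rule has_density_image[OF _ df to_b]) (auto intro!: sf)

  have p_fin: "AE t in N1. p t < \<infinity>" and b_fin: "AE w in N1 \<Otimes>\<^sub>M Na. b w < \<infinity>"
    and u_fin: "AE w in ?W4. u w < \<infinity>" and v_fin: "AE w in ?W3. v w < \<infinity>"
    unfolding p_def b_def u_def v_def
    by (intro rv_density_finite M dp db du dv sf)+
  \<comment> \<open>A joint density vanishes almost everywhere where a marginal does. This links the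
    guard \<open>0 < b\<close> of the conclusion to the guard \<open>0 < p\<close> of conditional
    independence.\<close>
  have b_pos: "AE w in N1 \<Otimes>\<^sub>M Na. 0 < b w \<longrightarrow> 0 < p (fst w)"
    using subdensity[OF measurable_fst db dp]
    by (auto simp: comp_def zero_less_iff_neq_zero b_def p_def elim: eventually_mono)
  have s1: "sigma_finite_measure (?W4 \<Otimes>\<^sub>M N1)" and s2: "sigma_finite_measure (?W3 \<Otimes>\<^sub>M N1)"
    and s3: "sigma_finite_measure ((Nc \<Otimes>\<^sub>M N1 \<Otimes>\<^sub>M Na) \<Otimes>\<^sub>M ?U)"
    and s4: "sigma_finite_measure ((N1 \<Otimes>\<^sub>M Na) \<Otimes>\<^sub>M ?U)"
    and s1': "sigma_finite_measure (N1 \<Otimes>\<^sub>M ?W4)" and s2': "sigma_finite_measure (N1 \<Otimes>\<^sub>M ?W3)"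
    by (intro sf)+
  \<comment> \<open>Conditioning on \<open>\<Theta>1\<close> puts \<open>f\<close> and
    \<open>q\<close> in the numerators, whereas the density of \<open>\<Theta>1\<close> given the
    rest uses \<open>f'\<close> and \<open>q'\<close>. As separate Radon-Nikodym derivatives they
    agree only almost everywhere.\<close>
  have f': "AE z in ?W4 \<Otimes>\<^sub>M N1. f' (snd z, fst z) = f z"
    using rv_density_measure_iso[OF s1 s1' df swap_W4 refl]
    by (simp add: f_def f'_def split_beta')
  have q': "AE z in ?W3 \<Otimes>\<^sub>M N1. q' (snd z, fst z) = q z"
    using rv_density_measure_iso[OF s2 s2' dq swap_W3 refl]
    by (simp add: q_def q'_def split_beta')
  have f'': "AE z in (Nc \<Otimes>\<^sub>M N1 \<Otimes>\<^sub>M Na) \<Otimes>\<^sub>M ?U. case z of ((c, t, a), \<theta>0, x) \<Rightarrow>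
      f ((\<theta>0, x, a, c), t) = f'' z"
    using rv_density_measure_iso[OF s3 s1 df'' iso_W4' refl]
    by (simp add: f_def f''_def split_beta')
  have q'': "AE z in (N1 \<Otimes>\<^sub>M Na) \<Otimes>\<^sub>M ?U. case z of ((t, a), \<theta>0, x) \<Rightarrow>
      q ((\<theta>0, x, a), t) = q'' z"
    using rv_density_measure_iso[OF s4 s2 dq'' iso_W3' refl]
    by (simp add: q_def q''_def split_beta')

  \<comment> \<open>Conditional independence as a product formula for the joint density\<close>
  have factor: "AE z in ?W4 \<Otimes>\<^sub>M N1. case z of ((\<theta>0, x, a, c), t) \<Rightarrow>
      0 < p t \<longrightarrow> f ((\<theta>0, x, a, c), t) = q ((\<theta>0, x, a), t) * K c t"
    \<comment> \<open>The hypothesis lists \<open>\<theta>1\<close> first, hence the pullback along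
      the swap. Finiteness of \<open>p\<close> is what lets the common denominator
      \<open>p t\<close> cancel.\<close>
    using nonsingular_AE[OF measure_iso_imp_nonsingular[OF swap_W4] cond_indep]
      nonsingular_AE[OF to_N1 p_fin]
  proof eventually_elim
    case (elim z)
    obtain \<theta>0 x a c t where z: "z = ((\<theta>0, x, a, c), t)" by (metis prod_cases5 surj_pair)
    from elim have "f ((\<theta>0, x, a, c), t) / p t = q ((\<theta>0, x, a), t) / p t * K c t" "p t < \<infinity>" if "0 < p t"
      using that
      by (simp_all add: z cond_density_def[of M ?W4] cond_density_def[of M ?W3] K_def f_def q_def p_def)
    then show ?case by (simp add: z ennreal_divide_cancel_times)
  qed

  have joint: "AE z in (Nc \<Otimes>\<^sub>M N1 \<Otimes>\<^sub>M Na) \<Otimes>\<^sub>M ?U. case z of ((c, t, a), w) \<Rightarrow>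
      0 < p t \<longrightarrow> f'' ((c, t, a), w) = q'' ((t, a), w) * K c t"
  proof -
    \<comment> \<open>The identity for \<open>q''\<close> lives on a space without \<open>c\<close>,
      so it is pulled back along the projection that forgets \<open>c\<close>.\<close>
    have "nonsingular ((Nc \<Otimes>\<^sub>M N1 \<Otimes>\<^sub>M Na) \<Otimes>\<^sub>M ?U) ((N1 \<Otimes>\<^sub>M Na) \<Otimes>\<^sub>M ?U) (map_prod snd (\<lambda>x. x))"
      by (intro nonsingular_map_prod nonsingular_snd nonsingular_id sf)
    from nonsingular_AE[OF this q''] f''
      nonsingular_AE[OF measure_iso_imp_nonsingular[OF iso_W4'] factor]
    show ?thesis by eventually_elim auto
  qed

  \<comment> \<open>Integrating out \<open>(\<theta>0, x)\<close>: the guidance does not depend on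
    \<open>a\<close>\<close>
  have sigma_W4: "sigma_finite_measure ?W4"
    and se: "sigma_finite_measure (Nc \<Otimes>\<^sub>M N1 \<Otimes>\<^sub>M Na)" and sU: "sigma_finite_measure ?U"
    by (intro sf)+
  have "AE y in Nc \<Otimes>\<^sub>M N1 \<Otimes>\<^sub>M Na. AE w in ?U. case y of (c, t, a) \<Rightarrow>
      0 < p t \<longrightarrow> f'' ((c, t, a), w) = q'' ((t, a), w) * K c t"
    using pair_sigma_finite.AE_pair[OF pair_sigma_finite.intro[OF se sU] joint]
    by (simp add: split_beta')
  moreover have "AE y in Nc \<Otimes>\<^sub>M N1 \<Otimes>\<^sub>M Na. e y = (\<integral>\<^sup>+w. f'' (y, w) \<partial>?U)"
    unfolding e_def f''_def
    by (rule prob_space.distributed_marginal_eq_joint1[OF M _ _ de df'']) (intro sf)+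
  moreover have "AE y in Nc \<Otimes>\<^sub>M N1 \<Otimes>\<^sub>M Na. b (snd y) = (\<integral>\<^sup>+w. q'' (snd y, w) \<partial>?U)"
  proof (rule nonsingular_AE[where T="N1 \<Otimes>\<^sub>M Na"])
    show "nonsingular (Nc \<Otimes>\<^sub>M N1 \<Otimes>\<^sub>M Na) (N1 \<Otimes>\<^sub>M Na) snd"
      by (intro nonsingular_snd sf)
    show "AE y in N1 \<Otimes>\<^sub>M Na. b y = (\<integral>\<^sup>+w. q'' (y, w) \<partial>?U)"
      unfolding b_def q''_def
      by (rule prob_space.distributed_marginal_eq_joint1[OF M _ _ db dq'']) (intro sf)+
  qed
  ultimately have e: "AE y in Nc \<Otimes>\<^sub>M N1 \<Otimes>\<^sub>M Na. case y of (c, t, a) \<Rightarrow>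
      0 < p t \<longrightarrow> e (c, t, a) = b (t, a) * K c t"
    \<comment> \<open>Membership in the space makes the section of \<open>q''\<close> at
      \<open>(t, a)\<close> measurable, so that \<open>K c t\<close>, constant in the integration
      variable, can leave the integral.\<close>
    using AE_space
  proof eventually_elim
    case (elim y)
    obtain c t a where y: "y = (c, t, a)" by (cases y)
    have [measurable]: "q'' \<in> borel_measurable ((N1 \<Otimes>\<^sub>M Na) \<Otimes>\<^sub>M ?U)"
      using distributed_borel_measurable[OF dq''] by (simp add: q''_def)
    have ta: "(t, a) \<in> space (N1 \<Otimes>\<^sub>M Na)"
      using elim(4) by (auto simp: y space_pair_measure)
    have "e (c, t, a) = b (t, a) * K c t" if "0 < p t"
    proof -
      have "e (c, t, a) = (\<integral>\<^sup>+w. q'' ((t, a), w) * K c t \<partial>?U)"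
        using elim(1,2) that by (auto simp: y intro!: nn_integral_cong_AE elim: eventually_mono)
      also have "\<dots> = (\<integral>\<^sup>+w. q'' ((t, a), w) \<partial>?U) * K c t"
        using ta by (intro nn_integral_multc) measurable
      finally show ?thesis using elim(3) by (simp add: y)
    qed
    then show ?case by (simp add: y)
  qed

  \<comment> \<open>Assembling the decomposition\<close>
  have main: "AE z in ?W4 \<Otimes>\<^sub>M N1. case z of ((\<theta>0, x, a, c), t) \<Rightarrow>
      0 < b (t, a) \<longrightarrow> b (t, a) < \<infinity> \<and> e (c, t, a) = b (t, a) * K c t \<and>
      f' (t, \<theta>0, x, a, c) = q' (t, \<theta>0, x, a) * K c t"
    using factor f' nonsingular_AE[OF to_W3 q'] nonsingular_AE[OF to_e e]
      nonsingular_AE[OF to_b b_fin] nonsingular_AE[OF to_b b_pos]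
    by eventually_elim auto
  \<comment> \<open>Passing to sections separates the quantifiers: the factor has to be chosen for
    almost every \<open>w\<close>, before \<open>t\<close>.\<close>
  have "AE w in ?W4. AE t in N1. case w of (\<theta>0, x, a, c) \<Rightarrow>
      0 < b (t, a) \<longrightarrow> b (t, a) < \<infinity> \<and> e (c, t, a) = b (t, a) * K c t \<and>
      f' (t, \<theta>0, x, a, c) = q' (t, \<theta>0, x, a) * K c t"
    using pair_sigma_finite.AE_pair[OF pair_sigma_finite.intro[OF sigma_W4 N1] main]
    by (simp add: split_beta')
  then show ?thesis
    using u_fin nonsingular_AE[OF drop_c v_fin]
  proof eventually_elim
    case (elim w)
    obtain \<theta>0 x a c where w: "w = (\<theta>0, x, a, c)" by (cases w)
    have "\<exists>r::real. r > 0 \<and> (AE t in N1. 0 < b (t, a) \<longrightarrow>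
        f' (t, \<theta>0, x, a, c) / u (\<theta>0, x, a, c) =
        ennreal r * (q' (t, \<theta>0, x, a) / v (\<theta>0, x, a) * (e (c, t, a) / b (t, a))))"
      if "0 < u (\<theta>0, x, a, c)" "0 < v (\<theta>0, x, a)"
    proof (intro exI conjI)
      have uv: "u (\<theta>0, x, a, c) < \<infinity>" "v (\<theta>0, x, a) < \<infinity>"
        using elim(2,3) by (simp_all add: w)
      \<comment> \<open>This fixes the witness: the ratio of the density of
        \<open>(\<theta>0, x, a)\<close> to that of \<open>(\<theta>0, x, a, c)\<close>, in which
        \<open>t\<close> does not occur.\<close>
      then show "0 < enn2real (v (\<theta>0, x, a) / u (\<theta>0, x, a, c))"
        using that by (intro enn2real_divide_pos)
      show "AE t in N1. 0 < b (t, a) \<longrightarrow>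
        f' (t, \<theta>0, x, a, c) / u (\<theta>0, x, a, c) =
        ennreal (enn2real (v (\<theta>0, x, a) / u (\<theta>0, x, a, c))) *
        (q' (t, \<theta>0, x, a) / v (\<theta>0, x, a) * (e (c, t, a) / b (t, a)))"
        using elim(1)[unfolded w prod.case]
      proof eventually_elim
        case (elim t)
        then show ?case
          using ennreal_ratio_decomposition[OF that(1) uv(1) that(2) uv(2), of "b (t, a)"]
          by metis
      qed
    qed
    then show ?case
      unfolding w cond_density_def f'_def q'_def b_def e_def u_def v_def by simp
  qed
qed

end
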